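(* Let $\Omega\subset\mathbb{R}^n$ be a domain (a connected open set). Suppose there exists a convex function $u:\Omega\to\mathbb{R}$ (convex in the sense defined in the context) whose gradient becomes unbounded near $\partial\Omega$, i.e. $\Vert\nabla u\Vert_{L^\infty(B_\delta(x)\cap\Omega)}=\infty$ for every $x\in\partial\Omega$ and every $\delta>0$. Then $\Omega$ is convex.
   Context: The set $\Omega$ is not assumed convex a priori. A function $u:\Omega\to\mathbb{R}$ is called convex if $u(\tau x+(1-\tau)y)\le\tau u(x)+(1-\tau)u(y)$ for all $x,y\in\Omega$ and all $\tau\in(0,1)$ such that $\tau x+(1-\tau)y\in\Omega$ (it is not required that the whole segment from $x$ to $y$ lie in $\Omega$). Such a function is locally Lipschitz continuous, hence differentiable almost everywhere; $\nabla u$ is considered only at those points where $u$ is differentiable, and $L^\infty$ norms are taken with respect to Lebesgue measure. $B_\delta(x)$ denotes the open ball of radius $\delta$ centered at $x$. The set $\Omega$ is convex if $\tau x+(1-\tau)y\in\Omega$ for all $x,y\in\Omega$ and $\tau\in(0,1)$. *)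

theory Defs
  imports "HOL-Analysis.Analysis"
begin

text \<open>The library predicate \<^const>\<open>convex_on\<close> presupposes that the domain is convex.
  Here only the point \<open>\<tau> x + (1 - \<tau>) y\<close> itself has to lie in the domain,
  not the whole segment from \<open>x\<close> to \<open>y\<close>.\<close>

definition convex_fun :: "'a::real_vector set \<Rightarrow> ('a \<Rightarrow> real) \<Rightarrow> bool" where
  "convex_fun \<Omega> u \<longleftrightarrow>
     (\<forall>x\<in>\<Omega>. \<forall>y\<in>\<Omega>. \<forall>\<tau>. 0 < \<tau> \<and> \<tau> < 1 \<and> \<tau> *\<^sub>R x + (1 - \<tau>) *\<^sub>R y \<in> \<Omega> \<longrightarrow>
        u (\<tau> *\<^sub>R x + (1 - \<tau>) *\<^sub>R y) \<le> \<tau> * u x + (1 - \<tau>) * u y)"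

text \<open>Meaningful only where \<open>u\<close> is differentiable. At points of an open set the gradient
  depends only on the values of \<open>u\<close> in that set.\<close>

definition gradient :: "('a::real_inner \<Rightarrow> real) \<Rightarrow> 'a \<Rightarrow> 'a" where
  "gradient u x = (THE D. GDERIV u x :> D)"

text \<open>The infimum of the essential bounds of \<open>|f|\<close> on \<open>S\<close> for Lebesgue measure. The essential
  supremum \<open>esssup\<close> of HOL-Probability is by convention infinite for non-measurable
  functions; this formula needs no measurability assumption on \<open>f\<close> or \<open>S\<close>.\<close>

definition Linf_norm :: "'a::euclidean_space set \<Rightarrow> ('a \<Rightarrow> 'b::real_normed_vector) \<Rightarrow> ennreal" where
  "Linf_norm S f = Inf {C. AE x in lebesgue. x \<in> S \<longrightarrow> ennreal (norm (f x)) \<le> C}"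

definition grad_Linf_norm :: "'a::euclidean_space set \<Rightarrow> ('a \<Rightarrow> real) \<Rightarrow> ennreal" where
  "grad_Linf_norm S u = Linf_norm {x \<in> S. u differentiable (at x)} (gradient u)"

end

theory Submission imports Defs begin

text \<open>At a point \<open>z\<close> where \<open>u\<close> is differentiable, the tangent plane lies below \<open>u\<close> on all of
  \<open>\<Omega>\<close>: for \<open>y \<in> \<Omega>\<close> the points \<open>z + t (y - z)\<close> with small \<open>t > 0\<close> lie in \<open>\<Omega>\<close> because \<open>\<Omega>\<close> is
  open, so the weak convexity inequality applies to them even if the segment from \<open>z\<close> to \<open>y\<close>
  leaves \<open>\<Omega>\<close>, and its difference quotients converge to the slope of the tangent plane
  (\<open>tangent_plane_below\<close>).

  An affine minorant of \<open>u\<close> on \<open>\<Omega>\<close> is bounded above at each point of the convex hull of \<open>\<Omega>\<close> by a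
  convex combination of values of \<open>u\<close>, hence by a constant that depends on the point but not on
  the minorant. A small cube in the (open) hull is spanned by its finitely many corners, so there
  the bound is uniform. If \<open>x\<close> is any point of the hull, the tangent planes at points \<open>z\<close> near \<open>x\<close>
  are therefore uniformly bounded above around \<open>x\<close>, while their heights \<open>u z\<close> are bounded below
  by one fixed tangent plane; this bounds their slopes (\<open>gradient_bounded_near_hull_point\<close>).

  Consequently a boundary point near which the gradient is unbounded cannot lie in the convex
  hull. So \<open>\<Omega>\<close> is open and closed relative to its hull, which is connected, and the two sets
  coincide.\<close>

lemma GDERIV_gradient:
  fixes u :: "'a::euclidean_space \<Rightarrow> real"
  assumes "u differentiable (at x)"
  shows "GDERIV u x :> gradient u x"
proof -
  obtain u' where u': "(u has_derivative u') (at x)"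
    using assms by (auto simp: differentiable_def)
  have "u' = (\<lambda>h. inner h (adjoint u' 1))"
    using adjoint_works[OF has_derivative_linear[OF u']] by fastforce
  then have "GDERIV u x :> adjoint u' 1"
    using u' by (metis gderiv_def)
  moreover have "D = E" if "GDERIV u x :> D" "GDERIV u x :> E" for D E
  proof -
    have "(\<lambda>h. inner h D) = (\<lambda>h. inner h E)"
      using that unfolding gderiv_def by (rule has_derivative_unique)
    then have "\<forall>h. inner h D = inner h E"
      by (simp add: fun_eq_iff)
    then show ?thesis
      by (simp only: vector_eq_ldot)
  qed
  ultimately show ?thesis
    unfolding gradient_def by (blast intro: theI)
qed

text \<open>Otherwise \<open>C\<close> would bound \<open>norm (f z)\<close> everywhere on \<open>S\<close>, hence essentially.\<close>

lemma exists_large_if_Linf_norm_infinite: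
  assumes "Linf_norm S f = \<infinity>"
  obtains z where "z \<in> S" "norm (f z) > C"
proof -
  have "\<not> (AE x in lebesgue. x \<in> S \<longrightarrow> ennreal (norm (f x)) \<le> ennreal C)"
  proof
    assume "AE x in lebesgue. x \<in> S \<longrightarrow> ennreal (norm (f x)) \<le> ennreal C"
    then have "Linf_norm S f \<le> ennreal C"
      unfolding Linf_norm_def by (intro Inf_lower) simp
    with assms show False by (simp add: top_unique)
  qed
  then obtain z where "z \<in> S" "\<not> ennreal (norm (f z)) \<le> ennreal C"
    using AE_I2[of lebesgue "\<lambda>x. x \<in> S \<longrightarrow> ennreal (norm (f x)) \<le> ennreal C"] by blast
  then show thesis
    using that by (meson ennreal_leI not_le)
qed

text \<open>Differentiability at \<open>z\<close> makes this a global statement although the weak convexity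
  inequality says nothing about the segment from \<open>z\<close> to \<open>y\<close> outside \<open>\<Omega>\<close>: only the part of it
  near \<open>z\<close> enters the limit of the difference quotients.\<close>

lemma tangent_plane_below:
  fixes u :: "'a::euclidean_space \<Rightarrow> real"
  assumes "open \<Omega>" "convex_fun \<Omega> u" "z \<in> \<Omega>" "y \<in> \<Omega>" "GDERIV u z :> p"
  shows "u z + inner p (y - z) \<le> u y"
proof -
  have line: "((\<lambda>t. z + t *\<^sub>R (y - z)) has_vector_derivative (y - z)) (at 0 within {0<..})"
    by (auto intro!: derivative_eq_intros)
  have "((\<lambda>t. u (z + t *\<^sub>R (y - z))) has_derivative (\<lambda>t. inner (t *\<^sub>R (y - z)) p))
      (at 0 within {0<..})"
    using has_derivative_compose[OF line[unfolded has_vector_derivative_def], of u "\<lambda>h. inner h p"]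
      assms(5) by (simp add: gderiv_def)
  then have "((\<lambda>t. u (z + t *\<^sub>R (y - z))) has_field_derivative inner p (y - z)) (at 0 within {0<..})"
    by (simp add: has_field_derivative_def inner_commute mult_commute_abs)
  then have lim: "((\<lambda>t. (u (z + t *\<^sub>R (y - z)) - u z) / t) \<longlongrightarrow> inner p (y - z)) (at_right 0)"
    by (simp add: has_field_derivative_iff)
  have "((\<lambda>t. z + t *\<^sub>R (y - z)) \<longlongrightarrow> z + 0 *\<^sub>R (y - z)) (at_right 0)"
    by (intro tendsto_intros)
  then have "\<forall>\<^sub>F t in at_right 0. z + t *\<^sub>R (y - z) \<in> \<Omega>"
    using topological_tendstoD[OF _ \<open>open \<Omega>\<close>] \<open>z \<in> \<Omega>\<close> by fastforce
  moreover have "\<forall>\<^sub>F t in at_right 0. 0 < t \<and> t < (1::real)"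
    by (auto simp: eventually_at_right_field intro: exI[of _ 1])
  ultimately have "\<forall>\<^sub>F t in at_right 0. (u (z + t *\<^sub>R (y - z)) - u z) / t \<le> u y - u z"
  proof eventually_elim
    case (elim t)
    have eq: "t *\<^sub>R y + (1 - t) *\<^sub>R z = z + t *\<^sub>R (y - z)"
      by (simp add: algebra_simps)
    have "u (z + t *\<^sub>R (y - z)) \<le> t * u y + (1 - t) * u z"
      using assms(2-4) elim unfolding convex_fun_def by (metis eq)
    with elim show ?case
      by (simp add: pos_divide_le_eq) (simp add: algebra_simps)
  qed
  from tendsto_upperbound[OF lim this] show ?thesis by simp
qed

text \<open>The point of this lemma is the order of the quantifiers: the bound \<open>M\<close> is the same for all
  affine minorants \<open>y \<mapsto> a + p \<bullet> y\<close>.\<close>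

lemma affine_minorants_bounded_on_hull:
  fixes u :: "'a::euclidean_space \<Rightarrow> real"
  assumes "c \<in> convex hull \<Omega>"
  shows "\<exists>M. \<forall>a p. (\<forall>y\<in>\<Omega>. a + inner p y \<le> u y) \<longrightarrow> a + inner p c \<le> M"
proof -
  define B where
    "B = {c. \<exists>M. \<forall>a p. (\<forall>y\<in>\<Omega>. a + inner p y \<le> u y) \<longrightarrow> a + inner p c \<le> M}"
  have "\<Omega> \<subseteq> B"
    unfolding B_def by blast
  moreover have "convex B"
  proof (rule convexI)
    fix c d and s t :: real
    assume "c \<in> B" "d \<in> B" and st: "0 \<le> s" "0 \<le> t" "s + t = 1"
    then obtain M N where
      MN: "\<And>a p. \<forall>y\<in>\<Omega>. a + inner p y \<le> u y \<Longrightarrow> a + inner p c \<le> M \<and> a + inner p d \<le> N"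
      unfolding B_def by blast
    have "a + inner p (s *\<^sub>R c + t *\<^sub>R d) \<le> s * M + t * N"
      if "\<forall>y\<in>\<Omega>. a + inner p y \<le> u y" for a p
    proof -
      have "a + inner p (s *\<^sub>R c + t *\<^sub>R d) = (s + t) * a + s * inner p c + t * inner p d"
        using st by (simp add: inner_add_right)
      also have "\<dots> = s * (a + inner p c) + t * (a + inner p d)"
        by (simp add: algebra_simps)
      also have "\<dots> \<le> s * M + t * N"
        using MN[OF that] st by (intro add_mono mult_left_mono) auto
      finally show ?thesis .
    qed
    then show "s *\<^sub>R c + t *\<^sub>R d \<in> B"
      unfolding B_def by blast
  qed
  ultimately have "convex hull \<Omega> \<subseteq> B"
    by (rule hull_minimal)
  with assms show ?thesis
    unfolding B_def by blast
qed

text \<open>An affine function on a cube is at most its largest value at a corner, so the finitely many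
  pointwise bounds at the corners combine to a bound on a neighbourhood.\<close>

lemma affine_minorants_locally_bounded_on_hull:
  fixes u :: "'a::euclidean_space \<Rightarrow> real"
  assumes "open \<Omega>" "x \<in> convex hull \<Omega>"
  obtains r M where "r > 0"
    "\<And>a p c. \<forall>y\<in>\<Omega>. a + inner p y \<le> u y \<Longrightarrow> c \<in> cball x r \<Longrightarrow> a + inner p c \<le> M"
proof -
  obtain e where e: "e > 0" "cball x e \<subseteq> convex hull \<Omega>"
    using open_convex_hull[OF assms(1)] assms(2) open_contains_cball by blast
  \<comment> \<open>a cube around \<open>x\<close> inside \<open>cball x e\<close>, which in turn contains \<open>cball x r\<close>\<close>
  define r where "r = e / real DIM('a)"
  have r: "r > 0"
    using e by (simp add: r_def)
  define Q where "Q = cbox (x - (\<Sum>i\<in>Basis. r *\<^sub>R i)) (x + (\<Sum>i\<in>Basis. r *\<^sub>R i))"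
  have Q_iff: "c \<in> Q \<longleftrightarrow> (\<forall>i\<in>Basis. \<bar>inner (c - x) i\<bar> \<le> r)" for c
    unfolding Q_def mem_box
    by (rule ball_cong) (auto simp: algebra_simps inner_sum_left_Basis inner_diff_left abs_le_iff)
  have "Q \<subseteq> cball x e"
  proof
    fix c assume "c \<in> Q"
    then have "norm (c - x) \<le> (\<Sum>i\<in>(Basis::'a set). r)"
      using norm_le_l1[of "c - x"] by (meson Q_iff order_trans sum_mono)
    then show "c \<in> cball x e"
      by (simp add: r_def dist_norm norm_minus_commute)
  qed
  have in_Q: "cball x r \<subseteq> Q"
    by (auto simp: Q_iff dist_norm norm_minus_commute intro: order_trans[OF Basis_le_norm])
  obtain S where S: "finite S" "Q = convex hull S"
    using cube_convex_hull[OF r, of x] unfolding Q_def by auto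
  have "\<forall>s\<in>S. \<exists>M. \<forall>a p. (\<forall>y\<in>\<Omega>. a + inner p y \<le> u y) \<longrightarrow> a + inner p s \<le> M"
    using affine_minorants_bounded_on_hull S \<open>Q \<subseteq> cball x e\<close> e
    by (metis hull_subset subset_iff)
  then obtain m where
    m: "\<And>s a p. s \<in> S \<Longrightarrow> \<forall>y\<in>\<Omega>. a + inner p y \<le> u y \<Longrightarrow> a + inner p s \<le> m s"
    by metis
  show thesis
  proof (rule that[OF r])
    fix a p c
    assume minorant: "\<forall>y\<in>\<Omega>. a + inner p y \<le> u y" and "c \<in> cball x r"
    have "S \<subseteq> {c. inner p c \<le> Max (m ` S) - a}"
      using m[OF _ minorant] S(1) by (force simp: le_diff_eq add.commute intro: order_trans Max_ge)
    then have "convex hull S \<subseteq> {c. inner p c \<le> Max (m ` S) - a}"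
      by (rule hull_minimal) (rule convex_halfspace_le)
    with \<open>c \<in> cball x r\<close> in_Q S show "a + inner p c \<le> Max (m ` S)"
      by (auto simp: algebra_simps)
  qed
qed

text \<open>The tangent plane at \<open>z\<close>, evaluated at distance \<open>r\<close> from \<open>z\<close> in its direction of steepest
  ascent, has the value \<open>u z + r * norm p\<close>, which the uniform bound on minorants controls.\<close>

lemma gradient_bounded_near_hull_point:
  fixes u :: "'a::euclidean_space \<Rightarrow> real"
  assumes "open \<Omega>" "convex_fun \<Omega> u" "x \<in> convex hull \<Omega>"
  obtains r C where "r > 0"
    "\<And>z p. z \<in> ball x r \<inter> \<Omega> \<Longrightarrow> GDERIV u z :> p \<Longrightarrow> norm p \<le> C"
proof (cases "\<exists>z\<^sub>0\<in>\<Omega>. \<exists>q. GDERIV u z\<^sub>0 :> q")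
  case False
  then show thesis
    using that[of 1 0] by auto
next
  case True
  then obtain z\<^sub>0 q where z0: "z\<^sub>0 \<in> \<Omega>" "GDERIV u z\<^sub>0 :> q"
    by blast
  obtain R M where "R > 0" and
    M: "\<And>a p c. \<forall>y\<in>\<Omega>. a + inner p y \<le> u y \<Longrightarrow> c \<in> cball x R \<Longrightarrow> a + inner p c \<le> M"
    using affine_minorants_locally_bounded_on_hull[OF assms(1,3), of u] by blast
  define r where "r = R / 2"
  have r: "r > 0"
    using \<open>R > 0\<close> by (simp add: r_def)
  define m where "m = u z\<^sub>0 - norm q * (norm (x - z\<^sub>0) + r)"
  show thesis
  proof (rule that[OF r])
    fix z p
    assume z: "z \<in> ball x r \<inter> \<Omega>" and p: "GDERIV u z :> p"
    have "norm (z - z\<^sub>0) \<le> norm (x - z\<^sub>0) + r"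
      using z norm_triangle_ineq[of "x - z\<^sub>0" "z - x"] by (simp add: dist_norm norm_minus_commute)
    then have "\<bar>inner q (z - z\<^sub>0)\<bar> \<le> norm q * (norm (x - z\<^sub>0) + r)"
      using Cauchy_Schwarz_ineq2 by (meson mult_left_mono norm_ge_zero order_trans)
    moreover have "u z\<^sub>0 + inner q (z - z\<^sub>0) \<le> u z"
      using tangent_plane_below assms(1,2) z0 z by blast
    ultimately have lower: "m \<le> u z"
      by (simp add: m_def abs_le_iff)
    \<comment> \<open>for \<open>p = 0\<close> this is \<open>z\<close> itself, by \<open>sgn 0 = 0\<close>\<close>
    define c where "c = z + r *\<^sub>R sgn p"
    have "dist z c \<le> r"
      using r by (simp add: c_def dist_norm norm_sgn)
    then have "c \<in> cball x R"
      using z dist_triangle[of x c z] by (simp add: r_def)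
    moreover have "\<forall>y\<in>\<Omega>. (u z - inner p z) + inner p y \<le> u y"
      using tangent_plane_below[OF assms(1,2) _ _ p] z by (auto simp: inner_diff_right algebra_simps)
    ultimately have "(u z - inner p z) + inner p c \<le> M"
      using M by blast
    moreover have "inner p (sgn p) = norm p"
      by (cases "p = 0") (simp_all add: sgn_div_norm dot_square_norm power2_eq_square)
    ultimately have "u z + r * norm p \<le> M"
      by (simp add: c_def inner_add_right)
    with lower have "norm p * r \<le> M - m"
      by (simp add: mult.commute)
    with r show "norm p \<le> (M - m) / r"
      by (simp add: pos_le_divide_eq)
  qed
qed

theorem theorem1:
  fixes \<Omega> :: "(real ^ 'n) set"
  assumes "open \<Omega>" and "connected \<Omega>"
    and "\<exists>u :: real ^ 'n \<Rightarrow> real. convex_fun \<Omega> u \<and>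
           (\<forall>x\<in>frontier \<Omega>. \<forall>\<delta>>0. grad_Linf_norm (ball x \<delta> \<inter> \<Omega>) u = \<infinity>)"
  shows "convex \<Omega>"
proof -
  obtain u :: "real ^ 'n \<Rightarrow> real" where u: "convex_fun \<Omega> u" and
    unbounded: "\<And>x \<delta>. x \<in> frontier \<Omega> \<Longrightarrow> \<delta> > 0 \<Longrightarrow> grad_Linf_norm (ball x \<delta> \<inter> \<Omega>) u = \<infinity>"
    using assms(3) by blast
  have "x \<notin> frontier \<Omega>" if hull: "x \<in> convex hull \<Omega>" for x
  proof
    assume x: "x \<in> frontier \<Omega>"
    obtain r C where "r > 0" and
      C: "\<And>z p. z \<in> ball x r \<inter> \<Omega> \<Longrightarrow> GDERIV u z :> p \<Longrightarrow> norm p \<le> C"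
      using gradient_bounded_near_hull_point[OF assms(1) u hull] by blast
    obtain z where "z \<in> ball x r \<inter> \<Omega>" "u differentiable (at z)" "norm (gradient u z) > C"
      using exists_large_if_Linf_norm_infinite unbounded[OF x \<open>r > 0\<close>]
      unfolding grad_Linf_norm_def by blast
    then show False
      using C GDERIV_gradient by fastforce
  qed
  then have "convex hull \<Omega> \<inter> frontier \<Omega> = {}"
    by blast
  moreover have "connected (convex hull \<Omega>)"
    by (simp add: convex_connected)
  ultimately have "\<Omega> = {} \<or> convex hull \<Omega> \<subseteq> \<Omega>"
    using connected_Int_frontier[of "convex hull \<Omega>" \<Omega>] hull_subset[of \<Omega> convex] by blast
  then show ?thesis
    by (metis convex_convex_hull convex_empty hull_subset subset_antisym)
qed

end
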